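(* Let $n \geq 4$ be an integer and let $q$ be a positive integer. In the $(q:1)$ Waiter-Client game on $E(K_n)$, Waiter has a strategy to force Client's graph at the end of the game to be a connected graph on all $n$ vertices of $K_n$ if and only if $q \leq \lfloor n/2 \rfloor - 1$.
   Context: The $(q:1)$ Waiter-Client game on $E(K_n)$ (for a positive integer $q$) is the following two-player perfect information game. In each round, Waiter offers Client exactly $q+1$ edges of the complete graph $K_n$ which have not been claimed before; Client chooses one of these edges, which he keeps, and the remaining $q$ edges are claimed by Waiter. If fewer than $q+1$ unclaimed edges remain, all of them are claimed by Waiter. The game ends when all edges of $K_n$ have been claimed. Client's graph is the graph with vertex set $V(K_n)$ whose edges are all the edges claimed by Client. *)

theory Defs
  imports Complex_Main "Graph_Theory.Digraph_Component"
begin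

text \<open>
  The (q:1) Waiter-Client game on a finite board X. A history lists the rounds played so far in
  chronological order; a round consists of the set offered by Waiter and the element of it that
  Client keeps, the other offered elements going to Waiter.
\<close>

type_synonym 'a wc_history = "('a set \<times> 'a) list"

definition unclaimed :: "'a set \<Rightarrow> 'a wc_history \<Rightarrow> 'a set" where
  "unclaimed X h = X - \<Union> (fst ` set h)"

definition client_claimed :: "'a wc_history \<Rightarrow> 'a set" where
  "client_claimed h = snd ` set h"

definition legal_offer :: "'a set \<Rightarrow> nat \<Rightarrow> 'a wc_history \<Rightarrow> 'a set \<Rightarrow> bool" where
  "legal_offer X q h A \<longleftrightarrow> A \<subseteq> unclaimed X h \<and> card A = q + 1"

inductive wc_play :: "'a set \<Rightarrow> nat \<Rightarrow> 'a wc_history \<Rightarrow> bool" for X q where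
  start: "wc_play X q []"
| round: "wc_play X q (h @ [(A, c)])" if "wc_play X q h" "legal_offer X q h A" "c \<in> A"

text \<open>
  Once fewer than q + 1 elements are unclaimed, Waiter takes all of them, so the elements that
  Client holds at the end of the game are those claimed in the rounds of the history.
\<close>

definition wc_complete :: "'a set \<Rightarrow> nat \<Rightarrow> 'a wc_history \<Rightarrow> bool" where
  "wc_complete X q h \<longleftrightarrow> wc_play X q h \<and> card (unclaimed X h) < q + 1"

definition waiter_strategy :: "'a set \<Rightarrow> nat \<Rightarrow> ('a wc_history \<Rightarrow> 'a set) \<Rightarrow> bool" where
  "waiter_strategy X q \<sigma> \<longleftrightarrow>
     (\<forall>h. wc_play X q h \<and> \<not> wc_complete X q h \<longrightarrow> legal_offer X q h (\<sigma> h))"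

definition follows :: "('a wc_history \<Rightarrow> 'a set) \<Rightarrow> 'a wc_history \<Rightarrow> bool" where
  "follows \<sigma> h \<longleftrightarrow> (\<forall>i < length h. fst (h ! i) = \<sigma> (take i h))"

text \<open>
  Client is unrestricted: the goal P, a property of the set of Client's elements, has to hold for
  every completed play in which Waiter follows the strategy. On a finite board every play
  consistent with a strategy extends to a completed one.
\<close>

definition waiter_can_force :: "'a set \<Rightarrow> nat \<Rightarrow> ('a set \<Rightarrow> bool) \<Rightarrow> bool" where
  "waiter_can_force X q P \<longleftrightarrow>
     (\<exists>\<sigma>. waiter_strategy X q \<sigma> \<and>
        (\<forall>h. wc_complete X q h \<and> follows \<sigma> h \<longrightarrow> P (client_claimed h)))"

definition complete_graph_edges :: "nat \<Rightarrow> nat set set" where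
  "complete_graph_edges n = {e. e \<subseteq> {..<n} \<and> card e = 2}"

text \<open>
  Graph_Theory represents an undirected graph as a symmetric digraph: the edge {u, v} becomes the
  two arcs (u, v) and (v, u).
\<close>

definition graph_of_edges :: "'a set \<Rightarrow> 'a set set \<Rightarrow> 'a pair_pre_digraph" where
  "graph_of_edges V E = \<lparr> pverts = V, parcs = {(u, v). u \<noteq> v \<and> {u, v} \<in> E} \<rparr>"

text \<open>The name \<open>connected\<close> is qualified to avoid the topological notion.\<close>

definition connected_graph :: "'a pair_pre_digraph \<Rightarrow> bool" where
  "connected_graph G \<longleftrightarrow> Digraph_Component.connected (with_proj G)"

end

theory Submission
  imports Defs
begin

text \<open>
  Put k = q + 1. A spanning tree takes n - 1 rounds, and they need k (n - 1) of the n (n - 1) / 2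
  edges; hence k \<open>\<le>\<close> n / 2 is necessary.

  Conversely, let 2 k \<open>\<le>\<close> n. On 2 k of the vertices Waiter grows a single component C of Client's
  graph, leaving all edges outside C untouched. Whenever she offers an edge from v to C, she offers
  all the unclaimed ones, so that no unclaimed edge ever lies inside C. If v is offered and Client
  attaches another vertex to C, then v has 1 unclaimed edge to C afterwards; a vertex that is not
  offered gains one. Every edge on the 2 k vertices has to be used, so the numbers of vertices
  outside C with i unclaimed edges to C have to be prescribed exactly, for all i from 1 to m = |C|.
  If b(m,i) - 1 denotes this number, the conditions are that the b(m,i) have sum 2 k and mean index
  (m + 1) / 2 for every m, and that b(m+1,i+1) \<open>\<le>\<close> b(m,i): the offer then contains
  b(m,i) - b(m+1,i+1) vertices with i unclaimed edges. They are met by distributing 2 k over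
  {1..m} as evenly as possible and symmetrically. The remaining n - 2 k vertices are attached one at
  a time, each by an offer of k edges to C.
\<close>

section \<open>Symmetric even distributions\<close>

text \<open>
  The number b(m,i) above, with N = 2 k. Each index receives N div m, and the remaining N mod m units
  go to the two ends of {1..m} or to its middle, according to the parity of N div m. This parity
  makes both a symmetric choice possible and the choices for m and m + 1 compatible.
\<close>

definition profile :: "nat \<Rightarrow> nat \<Rightarrow> nat \<Rightarrow> nat" where
  "profile N m i = N div m +
     (if even (N div m) then of_bool (2 * i \<le> N mod m \<or> 2 * (m + 1 - i) \<le> N mod m)
      else of_bool (m < 2 * i + N mod m \<and> 2 * i \<le> m + N mod m))"

lemma profile_1 [simp]:
  assumes "even N"
  shows "profile N (Suc 0) (Suc 0) = N"
  using assms by (auto simp: profile_def)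

lemma profile_pos:
  assumes "0 < m" "m \<le> N"
  shows "0 < profile N m i"
  using assms by (simp add: profile_def div_greater_zero_iff)

text \<open>In the even case both ends of \<open>{1..m}\<close> are treated alike. For odd
  \<open>N div m\<close>, evenness of N gives m and \<open>N mod m\<close> the same parity, so the
  middle block is centred exactly.\<close>

lemma profile_sym:
  assumes "even N" "i \<in> {1..m}"
  shows "profile N m (m + 1 - i) = profile N m i"
proof -
  have "N = m * (N div m) + N mod m" by simp
  with \<open>even N\<close> have "odd (N div m) \<Longrightarrow> even (m + N mod m)"
    by (metis even_add even_mult_iff)
  show ?thesis
  proof (cases "even (N div m)")
    case True
    then show ?thesis using assms(2) by (auto simp: profile_def)
  next
    case False
    then obtain x where "m + N mod m = 2 * x"
      using \<open>odd (N div m) \<Longrightarrow> even (m + N mod m)\<close> by (blast elim: evenE)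
    then show ?thesis using False assms(2) by (auto simp: profile_def)
  qed
qed

lemma sum_profile:
  assumes "even N" "0 < m"
  shows "(\<Sum>i=1..m. profile N m i) = N"
proof -
  define r where "r = N mod m"
  have N: "N = m * (N div m) + r" by (simp add: r_def)
  have "r < m" using assms by (simp add: r_def)
  \<comment> \<open>R collects the indices that get an extra unit, so the claim amounts to
    \<open>card R = r\<close>. For an even quotient, r is even and splits into two equal end blocks,
    disjoint because \<open>r < m\<close>.\<close>
  define R where "R = (if even (N div m) then {i \<in> {1..m}. 2 * i \<le> r \<or> 2 * (m + 1 - i) \<le> r}
    else {i \<in> {1..m}. m < 2 * i + r \<and> 2 * i \<le> m + r})"
  have "card R = r"
  proof (cases "even (N div m)")
    case True
    then have "even r" using N \<open>even N\<close> by (metis even_add even_mult_iff)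
    then obtain x where x: "r = 2 * x" by auto
    have "R = {1..x} \<union> {m + 1 - x..m}"
      using True x \<open>r < m\<close> by (auto simp: R_def)
    moreover have "{1..x} \<inter> {m + 1 - x..m} = {}" using x \<open>r < m\<close> by auto
    ultimately show ?thesis using x \<open>r < m\<close> by (simp add: card_Un_disjoint)
  next
    case False
    then have "even (m + r)" using N \<open>even N\<close> by (metis even_add even_mult_iff)
    then obtain x where x: "m + r = 2 * x" by (rule evenE)
    have "R = {x - r<..x}"
      using False x \<open>r < m\<close> by (auto simp: R_def)
    then show ?thesis using x \<open>r < m\<close> by simp
  qed
  have "(\<Sum>i=1..m. profile N m i) = (\<Sum>i=1..m. N div m + of_bool (i \<in> R))"
    by (intro sum.cong) (auto simp: profile_def R_def r_def)
  also have "\<dots> = m * (N div m) + card ({1..m} \<inter> R)"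
    by (simp add: sum.distrib)
  also have "{1..m} \<inter> R = R" by (auto simp: R_def)
  finally show ?thesis using N \<open>card R = r\<close> by simp
qed

text \<open>By symmetry, averaging the sum with its reversal replaces every weight i by (m + 1) /
  2.\<close>

lemma weighted_sum_profile:
  assumes "even N" "0 < m"
  shows "2 * (\<Sum>i=1..m. i * profile N m i) = (m + 1) * N"
proof -
  have "(\<Sum>i=1..m. i * profile N m i) = (\<Sum>i=1..m. (m + 1 - i) * profile N m (m + 1 - i))"
    by (rule sum.atLeastAtMost_rev[THEN trans]) simp
  also have "\<dots> = (\<Sum>i=1..m. (m + 1 - i) * profile N m i)"
    using profile_sym[OF assms(1)] by (intro sum.cong) auto
  finally have "2 * (\<Sum>i=1..m. i * profile N m i)
      = (\<Sum>i=1..m. i * profile N m i + (m + 1 - i) * profile N m i)"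
    by (simp add: sum.distrib)
  also have "\<dots> = (\<Sum>i=1..m. (m + 1) * profile N m i)"
    by (intro sum.cong) (auto simp flip: add_mult_distrib)
  also have "\<dots> = (m + 1) * N"
    by (simp only: sum_distrib_left[symmetric] sum_profile[OF assms])
  finally show ?thesis .
qed

text \<open>A smaller quotient at m + 1 absorbs the extra unit. If the quotients agree, the
  remainder at m is larger by that quotient, so extra indices at m + 1, moved down by one, are extra
  at m.\<close>

lemma profile_shift_le:
  assumes "0 < m" "m < N" "i \<in> {1..m}"
  shows "profile N (m + 1) (i + 1) \<le> profile N m i"
proof -
  define a r a' r' where "a = N div m" and "r = N mod m" and "a' = N div (m + 1)" and "r' = N mod (m + 1)"
  have N: "N = m * a + r" and N': "N = (m + 1) * a' + r'"
    by (simp_all only: a_def r_def a'_def r'_def mult_div_mod_eq)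
  have "a' \<le> a" unfolding a_def a'_def using assms by (intro div_le_mono2) auto
  have "a' > 0" unfolding a'_def using assms by (simp add: div_greater_zero_iff)
  show ?thesis
  proof (cases "a' = a")
    case True
    have "r = r' + a" using N N' True by simp
    have "even a \<Longrightarrow> 2 \<le> a" using True \<open>a' > 0\<close> by presburger
    show ?thesis
      unfolding profile_def a_def[symmetric] a'_def[symmetric] r_def[symmetric] r'_def[symmetric] True
      using \<open>r = r' + a\<close> \<open>even a \<Longrightarrow> 2 \<le> a\<close> assms True \<open>a' > 0\<close> by auto
  next
    case False
    then have "a' + 1 \<le> a" using \<open>a' \<le> a\<close> by simp
    then show ?thesis
      unfolding profile_def a_def[symmetric] a'_def[symmetric] by (auto intro: le_add1 order_trans)
  qed
qed

text \<open>The differences are the numbers of offered vertices with i unclaimed edges to C. By the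
  first identity, \<open>profile N (m + 1) 1 - 1\<close> offered vertices remain once one has joined
  C; by the second, the offer has N / 2 edges.\<close>

lemma sum_profile_drop:
  assumes "even N" "0 < m" "m < N"
  shows "(\<Sum>i=1..m. profile N m i - profile N (m + 1) (i + 1)) = profile N (m + 1) 1"
    and "2 * (\<Sum>i=1..m. i * (profile N m i - profile N (m + 1) (i + 1))) = N"
proof -
  let ?p = "profile N m" and ?p' = "profile N (m + 1)"
  have split: "(\<Sum>i=1..m + 1. f i) = f 1 + (\<Sum>i=1..m. f (i + 1))" for f :: "nat \<Rightarrow> nat"
    by (simp add: sum.atLeast_Suc_atMost sum.shift_bounds_cl_Suc_ivl del: sum.cl_ivl_Suc)
  have le: "?p' (i + 1) \<le> ?p i" if "i \<in> {1..m}" for i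
    using profile_shift_le[OF assms(2,3) that] .
  have total: "?p' 1 + (\<Sum>i=1..m. ?p' (i + 1)) = N"
    using sum_profile[OF assms(1), of "m + 1"] split[of ?p'] by linarith
  have "(\<Sum>i=1..m. ?p i - ?p' (i + 1)) = (\<Sum>i=1..m. ?p i) - (\<Sum>i=1..m. ?p' (i + 1))"
    using le by (rule sum_subtractf_nat)
  then show "(\<Sum>i=1..m. ?p i - ?p' (i + 1)) = ?p' 1"
    using sum_profile[OF assms(1,2)] total by linarith
  have "(\<Sum>i=1..m + 1. i * ?p' i) = ?p' 1 + (\<Sum>i=1..m. i * ?p' (i + 1)) + (\<Sum>i=1..m. ?p' (i + 1))"
    by (subst split) (simp add: sum.distrib)
  then have "2 * (\<Sum>i=1..m. i * ?p' (i + 1)) + 2 * N = (m + 2) * N"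
    using weighted_sum_profile[OF assms(1), of "m + 1"] total by simp
  then have "2 * (\<Sum>i=1..m. i * ?p' (i + 1)) = m * N"
    by (simp add: algebra_simps)
  moreover have "(\<Sum>i=1..m. i * (?p i - ?p' (i + 1))) = (\<Sum>i=1..m. i * ?p i) - (\<Sum>i=1..m. i * ?p' (i + 1))"
    unfolding diff_mult_distrib2 using le by (intro sum_subtractf_nat mult_le_mono2)
  moreover have "(\<Sum>i=1..m. i * ?p' (i + 1)) \<le> (\<Sum>i=1..m. i * ?p i)"
    using le by (intro sum_mono mult_le_mono2)
  moreover have "2 * (\<Sum>i=1..m. i * ?p i) = m * N + N"
    using weighted_sum_profile[OF assms(1,2)] by simp
  ultimately show "2 * (\<Sum>i=1..m. i * (?p i - ?p' (i + 1))) = N"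
    by linarith
qed

section \<open>Waiter-Client games as positions\<close>

text \<open>U is the set of unclaimed elements, K the set of elements that Client holds.\<close>

inductive waiter_wins :: "nat \<Rightarrow> ('a set \<Rightarrow> bool) \<Rightarrow> 'a set \<Rightarrow> 'a set \<Rightarrow> bool" for q P where
  stop: "waiter_wins q P U K" if "card U < q + 1" "P K"
| offer: "waiter_wins q P U K" if "A \<subseteq> U" "card A = q + 1"
    "\<And>c. c \<in> A \<Longrightarrow> waiter_wins q P (U - A) (insert c K)"

text \<open>Reaching a monotone goal early does not end the game; Waiter plays out the remaining
  rounds with arbitrary offers.\<close>

lemma waiter_wins_mono_goal:
  assumes "finite U" "P K" "\<And>K c. P K \<Longrightarrow> P (insert c K)"
  shows "waiter_wins q P U K"
  using assms(1,2)
proof (induction "card U" arbitrary: U K rule: less_induct)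
  case less
  show ?case
  proof (cases "card U < q + 1")
    case True
    then show ?thesis using less.prems by (intro stop)
  next
    case False
    then obtain A where A: "A \<subseteq> U" "card A = q + 1"
      by (meson not_less obtain_subset_with_card_n)
    then have "card (U - A) < card U"
      using False by (simp add: card_Diff_subset card_ge_0_finite)
    then show ?thesis
      using A less assms(3) by (intro offer[OF A]) auto
  qed
qed

section \<open>From winning positions to strategies on histories\<close>

lemma unclaimed_snoc: "unclaimed X (h @ [(A, c)]) = unclaimed X h - A"
  by (auto simp: unclaimed_def)

lemma client_claimed_snoc: "client_claimed (h @ [(A, c)]) = insert c (client_claimed h)"
  by (auto simp: client_claimed_def)

lemma finite_unclaimed: "finite X \<Longrightarrow> finite (unclaimed X h)"
  by (simp add: unclaimed_def)

lemma follows_snoc: "follows \<sigma> (h @ [x]) \<longleftrightarrow> follows \<sigma> h \<and> fst x = \<sigma> h"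
  by (auto simp add: follows_def All_less_Suc nth_append)

lemma waiter_wins_imp_can_force:
  assumes "finite X" "waiter_wins q P X {}"
  shows "waiter_can_force X q P"
proof -
  define wins where "wins h \<longleftrightarrow> waiter_wins q P (unclaimed X h) (client_claimed h)" for h
  \<comment> \<open>Legal offers are also demanded after plays that deviate from \<sigma>, where the
    position may be lost; hence the implication.\<close>
  define \<sigma> where "\<sigma> h = (SOME A. legal_offer X q h A \<and>
      (wins h \<longrightarrow> (\<forall>c\<in>A. wins (h @ [(A, c)]))))" for h
  have \<sigma>: "legal_offer X q h (\<sigma> h) \<and> (wins h \<longrightarrow> (\<forall>c\<in>\<sigma> h. wins (h @ [(\<sigma> h, c)])))"
    if "q + 1 \<le> card (unclaimed X h)" for h
    unfolding \<sigma>_def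
  proof (rule someI_ex, cases "wins h")
    case True
    then have "waiter_wins q P (unclaimed X h) (client_claimed h)"
      by (simp add: wins_def)
    then show "\<exists>A. legal_offer X q h A \<and> (wins h \<longrightarrow> (\<forall>c\<in>A. wins (h @ [(A, c)])))"
    proof cases
      case stop
      then show ?thesis using that by simp
    next
      case (offer A)
      then show ?thesis
        by (auto simp: legal_offer_def wins_def unclaimed_snoc client_claimed_snoc)
    qed
  next
    case False
    with that show "\<exists>A. legal_offer X q h A \<and> (wins h \<longrightarrow> (\<forall>c\<in>A. wins (h @ [(A, c)])))"
      unfolding legal_offer_def by (meson obtain_subset_with_card_n)
  qed
  have "wins h" if "wc_play X q h" "follows \<sigma> h" for h
    using that
  proof induction
    case start
    then show ?case using assms by (simp add: wins_def unclaimed_def client_claimed_def)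
  next
    case (round h A c)
    then have "A = \<sigma> h" "wins h" by (simp_all add: follows_snoc)
    moreover have "q + 1 \<le> card (unclaimed X h)"
      using round.hyps(2) card_mono[OF finite_unclaimed[OF assms(1)], of A h]
      by (simp add: legal_offer_def)
    ultimately show ?case using \<sigma> round.hyps(3) by blast
  qed
  \<comment> \<open>With fewer than q + 1 unclaimed elements no offer exists, so the position can be
    winning only by \<open>stop\<close>.\<close>
  moreover have "P (client_claimed h)" if "card (unclaimed X h) < q + 1" "wins h" for h
    using that(2) unfolding wins_def
  proof cases
    case (offer A)
    then show ?thesis
      using that(1) card_mono[OF finite_unclaimed[OF assms(1)] offer(1)] by simp
  qed
  moreover have "waiter_strategy X q \<sigma>"
    unfolding waiter_strategy_def wc_complete_def using \<sigma> not_less by blast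
  ultimately show ?thesis
    unfolding waiter_can_force_def wc_complete_def by (intro exI[of _ \<sigma>]) simp
qed

section \<open>Counting rounds and completing plays\<close>

lemma card_unclaimed:
  assumes "finite X" "wc_play X q h"
  shows "card (unclaimed X h) + (q + 1) * length h = card X"
  using assms(2)
proof induction
  case start
  then show ?case by (simp add: unclaimed_def)
next
  case (round h A c)
  then have A: "A \<subseteq> unclaimed X h" "card A = q + 1"
    by (simp_all add: legal_offer_def)
  have fin: "finite (unclaimed X h)"
    using assms(1) by (rule finite_unclaimed)
  have "card (unclaimed X h - A) = card (unclaimed X h) - (q + 1)"
    using A fin by (simp add: card_Diff_subset finite_subset)
  moreover have "q + 1 \<le> card (unclaimed X h)"
    using card_mono[OF fin A(1)] A(2) by simp
  ultimately show ?case using round.IH by (simp add: unclaimed_snoc)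
qed

text \<open>Forcing quantifies over all complete plays that follow the strategy. Such a play is
  needed to draw a necessary condition from it.\<close>

lemma ex_complete_play:
  assumes "finite X" "waiter_strategy X q \<sigma>"
  shows "\<exists>h. wc_complete X q h \<and> follows \<sigma> h"
proof -
  have "\<exists>h'. wc_complete X q h' \<and> follows \<sigma> h'" if "wc_play X q h" "follows \<sigma> h" for h
    using that
  proof (induction "card (unclaimed X h)" arbitrary: h rule: less_induct)
    case less
    show ?case
    proof (cases "wc_complete X q h")
      case False
      then have legal: "legal_offer X q h (\<sigma> h)"
        using assms(2) less.prems by (simp add: waiter_strategy_def)
      then obtain c where c: "c \<in> \<sigma> h"
        unfolding legal_offer_def by fastforce
      have play: "wc_play X q (h @ [(\<sigma> h, c)])"
        using less.prems(1) legal c by (rule wc_play.round)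
      show ?thesis
      proof (rule less.hyps[OF _ play])
        show "card (unclaimed X (h @ [(\<sigma> h, c)])) < card (unclaimed X h)"
          using card_unclaimed[OF assms(1) play] card_unclaimed[OF assms(1) less.prems(1)] by simp
        show "follows \<sigma> (h @ [(\<sigma> h, c)])"
          using less.prems(2) by (simp add: follows_snoc)
      qed
    qed (use less.prems in blast)
  qed
  moreover have "follows \<sigma> []" by (simp add: follows_def)
  ultimately show ?thesis using wc_play.start by blast
qed

section \<open>Connectedness by cuts\<close>

text \<open>
  Connectedness of the graph with vertex set C and edge set K, expressed through cuts. Edges in K
  that do not lie inside C play no role.
\<close>

definition spans :: "'a set set \<Rightarrow> 'a set \<Rightarrow> bool" where
  "spans K C \<longleftrightarrow> (\<forall>W. W \<noteq> {} \<longrightarrow> W \<subset> C \<longrightarrow> (\<exists>x\<in>W. \<exists>y\<in>C - W. {x, y} \<in> K))"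

lemma spans_mono: "spans K C \<Longrightarrow> K \<subseteq> K' \<Longrightarrow> spans K' C"
  unfolding spans_def by (meson subsetD)

lemma spans_singleton: "spans K {v}"
  unfolding spans_def by auto

lemma spans_insert:
  assumes "spans K C" "u \<in> C" "{u, v} \<in> K"
  shows "spans K (insert v C)"
  unfolding spans_def
proof (intro allI impI)
  fix W assume W: "W \<noteq> {}" "W \<subset> insert v C"
  \<comment> \<open>A cut of \<open>insert v C\<close> has \<open>{v}\<close> on one side or the
    other, or it cuts C properly. The edge \<open>{u, v}\<close> crosses it in the first two
    cases.\<close>
  consider "W \<inter> C = {}" | "C \<subseteq> W" | "W \<inter> C \<noteq> {}" "W \<inter> C \<subset> C" by blast
  then show "\<exists>x\<in>W. \<exists>y\<in>insert v C - W. {x, y} \<in> K"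
  proof cases
    case 1
    then have "v \<in> W" using W by blast
    then show ?thesis using 1 assms(2,3) by (metis DiffI Int_iff empty_iff insert_commute insertI2)
  next
    case 2
    then show ?thesis using W assms(2,3) by blast
  next
    case 3
    then obtain x y where "x \<in> W \<inter> C" "y \<in> C - W \<inter> C" "{x, y} \<in> K"
      using assms(1) unfolding spans_def by meson
    then show ?thesis by blast
  qed
qed

text \<open>No walk leaves a set that no edge leaves. Conversely, the set of vertices reachable from
  u would, if proper, be left by no edge.\<close>

lemma connected_graph_iff_spans:
  "connected_graph (graph_of_edges V E) \<longleftrightarrow> V \<noteq> {} \<and> spans E V"
proof -
  define R where "R = {(u, v). u \<noteq> v \<and> {u, v} \<in> E}"
  have R: "parcs (mk_symmetric (with_proj (graph_of_edges V E))) = R"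
    by (auto simp: mk_symmetric_def graph_of_edges_def R_def insert_commute)
  have "connected_graph (graph_of_edges V E) \<longleftrightarrow>
      V \<noteq> {} \<and> (\<forall>u\<in>V. \<forall>v\<in>V. (u, v) \<in> rtrancl_on V R)"
    unfolding connected_graph_def connected_def strongly_connected_def reachable_def
    by (simp add: R arcs_ends_conv) (simp add: mk_symmetric_def graph_of_edges_def)
  moreover have "spans E V" if "\<forall>u\<in>V. \<forall>v\<in>V. (u, v) \<in> rtrancl_on V R"
    unfolding spans_def
  proof (intro allI impI, rule ccontr)
    fix W assume W: "W \<noteq> {}" "W \<subset> V" and no_edge: "\<not> (\<exists>x\<in>W. \<exists>y\<in>V - W. {x, y} \<in> E)"
    from W obtain u v where "u \<in> W" "v \<in> V - W" by blast
    then have "(u, v) \<in> rtrancl_on V R" using that W by blast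
    then have "v \<in> W"
      by (induction rule: rtrancl_on_induct) (use \<open>u \<in> W\<close> no_edge R_def in auto)
    then show False using \<open>v \<in> V - W\<close> by blast
  qed
  moreover have "(u, v) \<in> rtrancl_on V R" if "spans E V" "u \<in> V" "v \<in> V" for u v
  proof (rule ccontr)
    assume "(u, v) \<notin> rtrancl_on V R"
    define W where "W = {w \<in> V. (u, w) \<in> rtrancl_on V R}"
    have "W \<noteq> {}" "W \<subset> V"
      using that \<open>(u, v) \<notin> rtrancl_on V R\<close> by (auto simp: W_def)
    then obtain x y where "x \<in> W" "y \<in> V - W" "{x, y} \<in> E"
      using \<open>spans E V\<close> unfolding spans_def by blast
    moreover from this have "(u, x) \<in> rtrancl_on V R" "(x, y) \<in> R" "y \<in> V"
      by (auto simp: W_def R_def)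
    ultimately have "(u, y) \<in> rtrancl_on V R"
      by (blast intro: rtrancl_on_into_rtrancl_on)
    then show False using \<open>y \<in> V - W\<close> by (auto simp: W_def)
  qed
  ultimately show ?thesis by blast
qed

text \<open>A vertex set grows from v: each cut supplies an edge to a new vertex, and this edge did
  not lie inside the set before.\<close>

lemma spans_card_le:
  assumes "finite V" "finite K" "spans K V"
  shows "card V \<le> card K + 1"
proof (cases "V = {}")
  case False
  then obtain v where "v \<in> V" by blast
  have "\<exists>W. v \<in> W \<and> W \<subseteq> V \<and> card W = Suc m \<and> m \<le> card {e \<in> K. e \<subseteq> W}"
    if "m < card V" for m
    using that
  proof (induction m)
    case 0
    show ?case using \<open>v \<in> V\<close> by (intro exI[of _ "{v}"]) simp
  next
    case (Suc m)
    then obtain W where W: "v \<in> W" "W \<subseteq> V" "card W = Suc m" "m \<le> card {e \<in> K. e \<subseteq> W}"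
      by auto
    then have "W \<subset> V" using Suc.prems by auto
    then obtain x y where xy: "x \<in> W" "y \<in> V - W" "{x, y} \<in> K"
      using \<open>spans K V\<close> W(1) unfolding spans_def by blast
    have "card (insert {x, y} {e \<in> K. e \<subseteq> W}) \<le> card {e \<in> K. e \<subseteq> insert y W}"
      using xy \<open>finite K\<close> by (intro card_mono) auto
    then have "Suc (card {e \<in> K. e \<subseteq> W}) \<le> card {e \<in> K. e \<subseteq> insert y W}"
      using xy \<open>finite K\<close> by simp
    moreover have "card (insert y W) = Suc (Suc m)"
      using W xy \<open>finite V\<close> by (simp add: finite_subset)
    ultimately show ?case using W xy by (intro exI[of _ "insert y W"]) auto
  qed
  moreover have "card V - 1 < card V"
    using False \<open>finite V\<close> by (simp add: card_gt_0_iff)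
  ultimately obtain W where "W \<subseteq> V" "card V - 1 \<le> card {e \<in> K. e \<subseteq> W}" by blast
  moreover have "card {e \<in> K. e \<subseteq> W} \<le> card K"
    using \<open>finite K\<close> by (intro card_mono) auto
  ultimately show ?thesis by linarith
qed simp

section \<open>The connectivity game\<close>

definition free_nbrs :: "'a set set \<Rightarrow> 'a set \<Rightarrow> 'a \<Rightarrow> 'a set" where
  "free_nbrs U C v = {u \<in> C. {u, v} \<in> U}"

text \<open>The shape of all of Waiter's planned offers. Indexing the edges by pairs lets their
  number be computed as a sum over S.\<close>

definition stars :: "'a set set \<Rightarrow> 'a set \<Rightarrow> 'a set \<Rightarrow> 'a set set" where
  "stars U C S = (\<lambda>(v, u). {u, v}) ` (SIGMA v:S. free_nbrs U C v)"

lemma edge_in_stars_iff: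
  assumes "C \<inter> S = {}" "w \<notin> C"
  shows "{u, w} \<in> stars U C S \<longleftrightarrow> u \<in> C \<and> w \<in> S \<and> {u, w} \<in> U"
  using assms by (fastforce simp: stars_def free_nbrs_def doubleton_eq_iff image_iff)

lemma waiter_wins_offer_stars:
  assumes "finite C" "finite S" "C \<inter> S = {}" "(\<Sum>v\<in>S. card (free_nbrs U C v)) = q + 1"
    and "\<And>u v. v \<in> S \<Longrightarrow> u \<in> free_nbrs U C v \<Longrightarrow>
      waiter_wins q P (U - stars U C S) (insert {u, v} K)"
  shows "waiter_wins q P U K"
proof (rule waiter_wins.offer)
  show "stars U C S \<subseteq> U" by (auto simp: stars_def free_nbrs_def)
  \<comment> \<open>As C and S are disjoint, an edge determines which of its ends lies in S.\<close>
  have "inj_on (\<lambda>(v, u). {u, v}) (SIGMA v:S. free_nbrs U C v)"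
    using assms(3) by (fastforce simp: inj_on_def free_nbrs_def doubleton_eq_iff)
  then show "card (stars U C S) = q + 1"
    using assms(1,2,4) by (simp add: stars_def card_image free_nbrs_def)
  show "waiter_wins q P (U - stars U C S) (insert c K)" if "c \<in> stars U C S" for c
    using that assms(5) by (auto simp: stars_def)
qed

text \<open>The second phase: v is joined to C whichever of the q + 1 offered edges Client keeps,
  and the edges with an end outside the enlarged C stay unclaimed.\<close>

lemma waiter_wins_attach:
  assumes "finite V" "finite U" "C \<subseteq> V" "q + 1 \<le> card C" "spans K C"
    and "\<And>u v. u \<in> V \<Longrightarrow> v \<in> V - C \<Longrightarrow> u \<noteq> v \<Longrightarrow> {u, v} \<in> U"
  shows "waiter_wins q (\<lambda>K. spans K V) U K"
  using assms(2-)
proof (induction "card (V - C)" arbitrary: U C K rule: less_induct)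
  case less
  show ?case
  proof (cases "C = V")
    case True
    then show ?thesis
      using less.prems spans_mono by (intro waiter_wins_mono_goal) (blast+)
  next
    case False
    then obtain v where v: "v \<in> V" "v \<notin> C" using less.prems(2) by blast
    \<comment> \<open>The star of v is taken over D instead of C so that it has exactly q + 1
      edges.\<close>
    obtain D where D: "D \<subseteq> C" "card D = q + 1" "finite D"
      using obtain_subset_with_card_n[OF less.prems(3)] by blast
    have "{d, v} \<in> U" if "d \<in> D" for d
      using that D v less.prems(2,5) by blast
    then have "free_nbrs U D v = D" by (auto simp: free_nbrs_def)
    show ?thesis
    proof (rule waiter_wins_offer_stars[of D "{v}"])
      fix u v' assume "v' \<in> {v}" "u \<in> free_nbrs U D v'"
      then have u: "u \<in> C" "v' = v" using D by (auto simp: free_nbrs_def)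
      show "waiter_wins q (\<lambda>K. spans K V) (U - stars U D {v}) (insert {u, v'} K)"
      proof (rule less.hyps[of "insert v C"])
        show "card (V - insert v C) < card (V - C)"
          using v \<open>finite V\<close> by (intro psubset_card_mono) auto
        show "q + 1 \<le> card (insert v C)"
          using less.prems(2,3) \<open>finite V\<close> v by (simp add: finite_subset)
        show "spans (insert {u, v'} K) (insert v C)"
          using u less.prems(4) by (intro spans_insert[of _ C u]) (auto intro: spans_mono)
        show "{x, w} \<in> U - stars U D {v}" if "x \<in> V" "w \<in> V - insert v C" "x \<noteq> w" for x w
          using that less.prems(5) edge_in_stars_iff[of D "{v}" w x U] D(1) v by blast
      qed (use less.prems v in auto)
    qed (use D v \<open>free_nbrs U D v = D\<close> in auto)
  qed
qed

text \<open>The first phase. Of the edges with an end outside C, only those between C and W - C may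
  have been claimed. The \<open>card C\<close> profile values sum to \<open>card W\<close>;
  subtracting 1 from each leaves \<open>card (W - C)\<close>, the number of vertices to be
  distributed.\<close>

lemma waiter_wins_grow:
  assumes "finite V" "finite U" "W \<subseteq> V" "card W = 2 * (q + 1)" "C \<subseteq> W" "C \<noteq> {}" "spans K C"
    and "\<And>u v. u \<in> V \<Longrightarrow> v \<in> V - C \<Longrightarrow> u \<noteq> v \<Longrightarrow> u \<notin> C \<or> v \<notin> W \<Longrightarrow> {u, v} \<in> U"
    and "\<And>v. v \<in> W - C \<Longrightarrow> card (free_nbrs U C v) \<in> {1..card C}"
    and "\<And>i. i \<in> {1..card C} \<Longrightarrow>
      card {v \<in> W - C. card (free_nbrs U C v) = i} = profile (card W) (card C) i - 1"
  shows "waiter_wins q (\<lambda>K. spans K V) U K"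
  using assms(2,5-)
proof (induction "card (W - C)" arbitrary: U C K rule: less_induct)
  case less
  define N m where "N = card W" and "m = card C"
  define d where "d v = card (free_nbrs U C v)" for v
  have "finite W" using assms(1,3) finite_subset by blast
  then have "finite C" using less.prems(2) finite_subset by blast
  have "0 < m" using less.prems(3) \<open>finite C\<close> by (simp add: m_def card_gt_0_iff)
  show ?case
  proof (cases "C = W")
    case True
    then show ?thesis using assms less.prems by (intro waiter_wins_attach[of V _ C]) auto
  next
    case False
    then have "m < N"
      unfolding m_def N_def using less.prems(2) \<open>finite W\<close> by (intro psubset_card_mono) auto
    have "even N" using assms(4) by (simp add: N_def)
    define D where "D i = {v \<in> W - C. d v = i}" for i
    define drop where "drop i = profile N m i - profile N (m + 1) (i + 1)" for i
    have card_D: "card (D i) = profile N m i - 1" if "i \<in> {1..m}" for i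
      using less.prems(7) that by (simp add: D_def d_def N_def m_def)
    have pos: "0 < profile N (m + 1) i" for i
      using \<open>m < N\<close> by (intro profile_pos) auto
    \<comment> \<open>The 1 missing in \<open>card_D\<close> is covered by the positive profile
      value subtracted in \<open>drop\<close>.\<close>
    have "drop i \<le> card (D i)" if "i \<in> {1..m}" for i
      unfolding card_D[OF that] drop_def using pos[of "i + 1"] by (intro diff_le_mono2) simp
    then have "\<exists>S. S \<subseteq> D i \<and> card S = drop i" if "i \<in> {1..m}" for i
      using that by (meson obtain_subset_with_card_n)
    then obtain S where S: "\<And>i. i \<in> {1..m} \<Longrightarrow> S i \<subseteq> D i" "\<And>i. i \<in> {1..m} \<Longrightarrow> card (S i) = drop i"
      by metis
    define T where "T = (\<Union>i\<in>{1..m}. S i)"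
    have finite_D: "finite (D i)" for i using \<open>finite W\<close> by (simp add: D_def)
    then have finite_S: "finite (S i)" if "i \<in> {1..m}" for i
      using S(1)[OF that] finite_subset by blast
    then have "finite T" by (auto simp: T_def)
    have T_sub: "T \<subseteq> W - C" using S(1) unfolding T_def D_def by blast
    have disj: "S i \<inter> S j = {}" if "i \<in> {1..m}" "j \<in> {1..m}" "i \<noteq> j" for i j
      using S(1)[OF that(1)] S(1)[OF that(2)] that(3) by (auto simp: D_def)
    have "card T = (\<Sum>i=1..m. card (S i))"
      unfolding T_def using finite_S disj by (intro card_UN_disjoint) auto
    then have card_T: "card T = profile N (m + 1) 1"
      using S(2) sum_profile_drop(1)[OF \<open>even N\<close> \<open>0 < m\<close> \<open>m < N\<close>] by (simp add: drop_def)
    have "sum d T = (\<Sum>i=1..m. sum d (S i))"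
      unfolding T_def using finite_S disj by (intro sum.UNION_disjoint) auto
    also have "\<dots> = (\<Sum>i=1..m. i * drop i)"
    proof (rule sum.cong)
      fix i assume i: "i \<in> {1..m}"
      then have "sum d (S i) = sum (\<lambda>_. i) (S i)"
        using S(1)[OF i] by (intro sum.cong) (auto simp: D_def)
      then show "sum d (S i) = i * drop i" using S(2)[OF i] by simp
    qed simp
    finally have sum_T: "sum d T = q + 1"
      using sum_profile_drop(2)[OF \<open>even N\<close> \<open>0 < m\<close> \<open>m < N\<close>] assms(4)
      by (simp add: drop_def N_def)
    show ?thesis
    proof (rule waiter_wins_offer_stars[of C T])
      show "C \<inter> T = {}" using T_sub by blast
      show "(\<Sum>v\<in>T. card (free_nbrs U C v)) = q + 1" using sum_T by (simp add: d_def)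
      fix u v assume v: "v \<in> T" and u: "u \<in> free_nbrs U C v"
      define U' C' where "U' = U - stars U C T" and "C' = insert v C"
      have v': "v \<in> W" "v \<notin> C" "v \<in> V" using v T_sub assms(3) by auto
      have "u \<in> C" using u by (simp add: free_nbrs_def)
      have U': "{x, w} \<in> U' \<longleftrightarrow> {x, w} \<in> U \<and> \<not> (x \<in> C \<and> w \<in> T)" if "w \<notin> C" for x w
        using edge_in_stars_iff[OF \<open>C \<inter> T = {}\<close> that] by (auto simp: U'_def)
      \<comment> \<open>An offered w loses all its edges to C and keeps only the one to v. Any other
        w gains that edge, which is unclaimed since both its ends were outside C.\<close>
      have d': "card (free_nbrs U' C' w) = (if w \<in> T then 1 else d w + 1)" if w: "w \<in> W - C'" for w
      proof -
        have "w \<notin> C" "w \<noteq> v" "w \<in> V" using w assms(3) by (auto simp: C'_def)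
        then have "{v, w} \<in> U" using less.prems(5)[of v w] v' by simp
        then have "free_nbrs U' C' w = (if w \<in> T then {v} else insert v (free_nbrs U C w))"
          using U'[OF \<open>w \<notin> C\<close>] v' by (auto simp: free_nbrs_def C'_def)
        moreover have "v \<notin> free_nbrs U C w" "finite (free_nbrs U C w)"
          using v' \<open>finite C\<close> by (simp_all add: free_nbrs_def)
        ultimately show ?thesis by (simp add: d_def)
      qed
      have card_C': "card C' = m + 1"
        using v' \<open>finite C\<close> by (simp add: C'_def m_def)
      have "waiter_wins q (\<lambda>K. spans K V) U' (insert {u, v} K)"
      proof (rule less.hyps[of C'])
        show "card (W - C') < card (W - C)"
          using v' \<open>finite W\<close> by (intro psubset_card_mono) (auto simp: C'_def)
        show "finite U'" using less.prems(1) by (simp add: U'_def)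
        show "C' \<subseteq> W" "C' \<noteq> {}" using v' less.prems(2) by (auto simp: C'_def)
        show "spans (insert {u, v} K) C'"
          unfolding C'_def using \<open>u \<in> C\<close> less.prems(4)
          by (intro spans_insert[of _ C u]) (auto intro: spans_mono)
        show "{x, w} \<in> U'" if "x \<in> V" "w \<in> V - C'" "x \<noteq> w" "x \<notin> C' \<or> w \<notin> W" for x w
          using that less.prems(5)[of x w] U'[of w x] T_sub by (auto simp: C'_def)
        show "card (free_nbrs U' C' w) \<in> {1..card C'}" if "w \<in> W - C'" for w
          using less.prems(6)[of w] that unfolding d'[OF that] card_C'
          by (auto simp: C'_def d_def m_def)
        show "card {w \<in> W - C'. card (free_nbrs U' C' w) = j} = profile (card W) (card C') j - 1"
          if j: "j \<in> {1..card C'}" for j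
        proof (cases "j = 1")
          case True
          \<comment> \<open>A vertex that was not offered had at least one free edge to C and now
            has at least two.\<close>
          have "card (free_nbrs U' C' w) = j \<longleftrightarrow> w \<in> T" if "w \<in> W - C'" for w
            unfolding d'[OF that] True
            using less.prems(6)[of w] that by (auto simp: C'_def d_def)
          then have "{w \<in> W - C'. card (free_nbrs U' C' w) = j} = {w \<in> W - C'. w \<in> T}"
            by blast
          also have "\<dots> = T - {v}" using T_sub by (auto simp: C'_def)
          finally have "{w \<in> W - C'. card (free_nbrs U' C' w) = j} = T - {v}" .
          then show ?thesis
            using card_T v \<open>finite T\<close> by (simp add: True card_C' N_def)
        next
          case False
          define i where "i = j - 1"
          then have i: "i \<in> {1..m}" "j = i + 1" using j False card_C' by auto
          have T_iff: "w \<in> T \<longleftrightarrow> w \<in> S i" if "w \<in> D i" for w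
          proof
            assume "w \<in> T"
            then obtain l where "l \<in> {1..m}" "w \<in> S l" by (auto simp: T_def)
            then show "w \<in> S i" using S(1)[of l] that by (auto simp: D_def)
          qed (use i(1) T_def in blast)
          \<comment> \<open>As j > 1, offered vertices do not count here; the others come from level
            i = j - 1. The vertex v needs no separate exclusion, being in T.\<close>
          have "{w \<in> W - C'. card (free_nbrs U' C' w) = j} = {w \<in> W - C'. w \<notin> T \<and> d w = i}"
            using i d' by (auto split: if_splits)
          also have "\<dots> = D i - T" using v by (auto simp: D_def C'_def)
          also have "\<dots> = D i - S i" using T_iff by blast
          finally have "card {w \<in> W - C'. card (free_nbrs U' C' w) = j} = profile N m i - 1 - drop i"
            using S[OF i(1)] finite_S[OF i(1)] card_D[OF i(1)] by (simp add: card_Diff_subset)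
          \<comment> \<open>Since the profile at m + 1 does not exceed that at m, the truncated
            differences cancel to \<open>profile N (m + 1) (i + 1) - 1\<close>.\<close>
          then show ?thesis
            using profile_shift_le[OF \<open>0 < m\<close> \<open>m < N\<close> i(1)] i(2) card_C'
            by (simp add: drop_def N_def)
        qed
      qed
      then show "waiter_wins q (\<lambda>K. spans K V) (U - stars U C T) (insert {u, v} K)"
        by (simp add: U'_def)
    qed (use \<open>finite C\<close> \<open>finite T\<close> in auto)
  qed
qed

section \<open>The complete graph as board: starting position and necessary bound\<close>

lemma finite_complete_graph_edges: "finite (complete_graph_edges n)"
  unfolding complete_graph_edges_def by (rule finite_subset[of _ "Pow {..<n}"]) auto

lemma card_complete_graph_edges: "card (complete_graph_edges n) = n choose 2"
  unfolding complete_graph_edges_def by (simp add: n_subsets)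

lemma edge_in_complete_graph_iff:
  "{u, v} \<in> complete_graph_edges n \<longleftrightarrow> u < n \<and> v < n \<and> u \<noteq> v"
  by (auto simp: complete_graph_edges_def card_2_iff doubleton_eq_iff)

text \<open>Growth starts from C = {0}: each other vertex of W has one free edge to C, and their
  number is the single profile value at m = 1, minus 1.\<close>

lemma waiter_wins_complete_graph:
  assumes "2 * (q + 1) \<le> n"
  shows "waiter_wins q (\<lambda>K. spans K {..<n}) (complete_graph_edges n) {}"
proof (rule waiter_wins_grow[where C = "{0}" and W = "{..<2 * (q + 1)}"])
  have nbrs: "free_nbrs (complete_graph_edges n) {0} v = {0}" if "v \<in> {..<2 * (q + 1)} - {0}" for v
    using that assms by (auto simp: free_nbrs_def edge_in_complete_graph_iff)
  then show "card (free_nbrs (complete_graph_edges n) {0} v) \<in> {1..card {0::nat}}"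
    if "v \<in> {..<2 * (q + 1)} - {0}" for v
    using that by simp
  have "{v \<in> {..<2 * (q + 1)} - {0}. card (free_nbrs (complete_graph_edges n) {0} v) = 1}
      = {..<2 * (q + 1)} - {0}"
    using nbrs by auto
  then show "card {v \<in> {..<2 * (q + 1)} - {0}. card (free_nbrs (complete_graph_edges n) {0} v) = i}
      = profile (card {..<2 * (q + 1)}) (card {0::nat}) i - 1" if "i \<in> {1..card {0::nat}}" for i
    using that by simp
qed (use assms in \<open>auto simp: finite_complete_graph_edges edge_in_complete_graph_iff spans_singleton\<close>)

lemma bias_le_of_waiter_can_force:
  assumes "2 \<le> n"
    and "waiter_can_force (complete_graph_edges n) q (\<lambda>C. connected_graph (graph_of_edges {..<n} C))"
  shows "2 * (q + 1) \<le> n"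
proof -
  let ?X = "complete_graph_edges n"
  obtain h where h: "wc_complete ?X q h" "spans (client_claimed h) {..<n}"
    using assms(2) ex_complete_play[OF finite_complete_graph_edges]
    unfolding waiter_can_force_def connected_graph_iff_spans by metis
  have "n \<le> card (client_claimed h) + 1"
    using spans_card_le[OF _ _ h(2)] by (simp add: client_claimed_def)
  also have "card (client_claimed h) \<le> length h"
    unfolding client_claimed_def using card_image_le[of "set h" snd] card_length[of h] by simp
  \<comment> \<open>Client gains at most one edge per round, so at least n - 1 rounds of q + 1 edges
    were played.\<close>
  finally have "(q + 1) * (n - 1) \<le> (q + 1) * length h"
    by (intro mult_le_mono2) simp
  also have "\<dots> \<le> n choose 2"
    using card_unclaimed[OF finite_complete_graph_edges, of n q h] h(1)
    by (simp add: wc_complete_def card_complete_graph_edges)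
  finally have "2 * (q + 1) * (n - 1) \<le> n * (n - 1)"
    by (simp add: choose_two)
  then have "0 < n - 1 \<longrightarrow> 2 * (q + 1) \<le> n"
    by (simp only: mult_le_cancel2)
  then show ?thesis using assms(1) by simp
qed

theorem theorem1p3:
  fixes n q :: nat
  assumes "n \<ge> 4" and "q > 0"
  shows "waiter_can_force (complete_graph_edges n) q (\<lambda>C. connected_graph (graph_of_edges {..<n} C))
    \<longleftrightarrow> int q \<le> \<lfloor>real n / 2\<rfloor> - 1"
proof -
  have "int q \<le> \<lfloor>real n / 2\<rfloor> - 1 \<longleftrightarrow> 2 * (q + 1) \<le> n"
    using le_floor_iff[of "int (q + 1)" "real n / 2"] by auto
  \<comment> \<open>\<open>spans\<close> holds vacuously for an empty vertex set, whereas
    \<open>connected_graph\<close> requires a vertex.\<close>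
  moreover have "{..<n} \<noteq> {}" using assms(1) by (auto simp: lessThan_empty_iff)
  ultimately show ?thesis
    using assms(1) bias_le_of_waiter_can_force[of n q]
      waiter_wins_imp_can_force[OF finite_complete_graph_edges waiter_wins_complete_graph, of q n]
    by (auto simp: connected_graph_iff_spans)
qed

end
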